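(* Let $R$ be a commutative ring with identity and let $X=\operatorname{Spec}(R)$ be endowed with the Zariski topology. Then a subset $C\subseteq X$ is a connected component of $X$ if and only if $C$ is of the form $V(M)$ for some max-regular ideal $M$ of $R$.
   Context: An ideal $I$ of a commutative ring $R$ is called a regular ideal if it is generated by a set of idempotents of $R$; it is a proper regular ideal if moreover $I\neq R$. A max-regular ideal of $R$ is a maximal element of the poset of proper regular ideals of $R$ ordered by inclusion. For an ideal $I$ of $R$, $V(I)=\{\mathfrak{p}\in\operatorname{Spec}(R) : I\subseteq\mathfrak{p}\}$. *)

theory Defs
  imports "HOL-Analysis.Abstract_Topology_2" "HOL-Algebra.Ideal"
begin

definition idempotent_elem :: "('a, 'b) ring_scheme \<Rightarrow> 'a \<Rightarrow> bool" where
  "idempotent_elem R e \<longleftrightarrow> e \<in> carrier R \<and> e \<otimes>\<^bsub>R\<^esub> e = e"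

definition regular_ideal :: "('a, 'b) ring_scheme \<Rightarrow> 'a set \<Rightarrow> bool" where
  "regular_ideal R I \<longleftrightarrow> (\<exists>E. (\<forall>e\<in>E. idempotent_elem R e) \<and> I = Idl\<^bsub>R\<^esub> E)"

definition proper_regular_ideal :: "('a, 'b) ring_scheme \<Rightarrow> 'a set \<Rightarrow> bool" where
  "proper_regular_ideal R I \<longleftrightarrow> regular_ideal R I \<and> I \<noteq> carrier R"

definition max_regular_ideal :: "('a, 'b) ring_scheme \<Rightarrow> 'a set \<Rightarrow> bool" where
  "max_regular_ideal R M \<longleftrightarrow>
     proper_regular_ideal R M \<and> (\<forall>J. proper_regular_ideal R J \<longrightarrow> M \<subseteq> J \<longrightarrow> J = M)"

definition prime_spectrum :: "('a, 'b) ring_scheme \<Rightarrow> 'a set set" where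
  "prime_spectrum R = {P. primeideal P R}"

definition vanishing_locus :: "('a, 'b) ring_scheme \<Rightarrow> 'a set \<Rightarrow> 'a set set" where
  "vanishing_locus R I = {P \<in> prime_spectrum R. I \<subseteq> P}"

(* For a commutative ring the predicate below is a topology (istopology_zariski), as the
   abstraction function topology requires. *)
definition zariski_topology :: "('a, 'b) ring_scheme \<Rightarrow> 'a set topology" where
  "zariski_topology R =
     topology (\<lambda>U. \<exists>I. ideal I R \<and> U = prime_spectrum R - vanishing_locus R I)"

lemma (in cring) vanishing_locus_Int:
  assumes "ideal I R" "ideal J R"
  shows "vanishing_locus R (I \<inter> J) = vanishing_locus R I \<union> vanishing_locus R J"
proof -
  have "I \<subseteq> P \<or> J \<subseteq> P" if P: "primeideal P R" and sub: "I \<inter> J \<subseteq> P" for P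
  proof (rule ccontr)
    assume "\<not> (I \<subseteq> P \<or> J \<subseteq> P)"
    then obtain a b where a: "a \<in> I" "a \<notin> P" and b: "b \<in> J" "b \<notin> P" by blast
    have c: "a \<in> carrier R" "b \<in> carrier R"
      using a b assms by (auto intro: additive_subgroup.a_Hcarr ideal.axioms(1))
    have "a \<otimes> b \<in> I" "a \<otimes> b \<in> J"
      using ideal.I_r_closed[OF assms(1) a(1) c(2)] ideal.I_l_closed[OF assms(2) b(1) c(1)] by auto
    then have "a \<otimes> b \<in> P" using sub by blast
    then show False using primeideal.I_prime[OF P c] a b by blast
  qed
  then show ?thesis
    unfolding vanishing_locus_def prime_spectrum_def by blast
qed

lemma (in cring) istopology_zariski:
  "istopology (\<lambda>U. \<exists>I. ideal I R \<and> U = prime_spectrum R - vanishing_locus R I)"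
  unfolding istopology_def
proof (intro conjI allI impI)
  fix S T
  assume "\<exists>I. ideal I R \<and> S = prime_spectrum R - vanishing_locus R I"
    and "\<exists>I. ideal I R \<and> T = prime_spectrum R - vanishing_locus R I"
  then obtain I J where "ideal I R" "S = prime_spectrum R - vanishing_locus R I"
    "ideal J R" "T = prime_spectrum R - vanishing_locus R J" by blast
  then have "ideal (I \<inter> J) R" "S \<inter> T = prime_spectrum R - vanishing_locus R (I \<inter> J)"
    by (auto simp: vanishing_locus_Int i_intersect)
  then show "\<exists>I. ideal I R \<and> S \<inter> T = prime_spectrum R - vanishing_locus R I" by blast
next
  fix \<K>
  assume "\<forall>U\<in>\<K>. \<exists>I. ideal I R \<and> U = prime_spectrum R - vanishing_locus R I"
  then obtain f where f: "\<And>U. U \<in> \<K> \<Longrightarrow> ideal (f U) R"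
    "\<And>U. U \<in> \<K> \<Longrightarrow> U = prime_spectrum R - vanishing_locus R (f U)" by metis
  let ?S = "\<Union>U\<in>\<K>. f U"
  have sub: "?S \<subseteq> carrier R"
    using f(1) by (auto intro: additive_subgroup.a_Hcarr ideal.axioms(1))
  have "Idl ?S \<subseteq> P \<longleftrightarrow> (\<forall>U\<in>\<K>. f U \<subseteq> P)" if "primeideal P R" for P
  proof
    assume "Idl ?S \<subseteq> P"
    then show "\<forall>U\<in>\<K>. f U \<subseteq> P" using genideal_self[OF sub] by blast
  next
    assume "\<forall>U\<in>\<K>. f U \<subseteq> P"
    then show "Idl ?S \<subseteq> P"
      using genideal_minimal[OF primeideal.axioms(1)[OF that]] by blast
  qed
  then have P: "P \<in> vanishing_locus R (Idl ?S) \<longleftrightarrow> (\<forall>U\<in>\<K>. P \<in> vanishing_locus R (f U))"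
    if "P \<in> prime_spectrum R" for P
    using that by (simp add: vanishing_locus_def prime_spectrum_def)
  have mem: "P \<in> U \<longleftrightarrow> P \<in> prime_spectrum R \<and> P \<notin> vanishing_locus R (f U)" if "U \<in> \<K>" for P U
    using f(2)[OF that] by blast
  have "\<Union>\<K> = prime_spectrum R - vanishing_locus R (Idl ?S)"
  proof (intro equalityI subsetI)
    fix Q assume "Q \<in> \<Union>\<K>"
    then obtain U where "U \<in> \<K>" "Q \<in> U" by blast
    then show "Q \<in> prime_spectrum R - vanishing_locus R (Idl ?S)"
      using P mem by simp blast
  next
    fix Q assume Q: "Q \<in> prime_spectrum R - vanishing_locus R (Idl ?S)"
    then obtain U where "U \<in> \<K>" "Q \<notin> vanishing_locus R (f U)" using P by blast
    then show "Q \<in> \<Union>\<K>" using mem Q by blast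
  qed
  then show "\<exists>I. ideal I R \<and> \<Union>\<K> = prime_spectrum R - vanishing_locus R I"
    using genideal_ideal[OF sub] by blast
qed

lemma (in cring) openin_zariski_topology:
  "openin (zariski_topology R) U \<longleftrightarrow>
     (\<exists>I. ideal I R \<and> U = prime_spectrum R - vanishing_locus R I)"
  by (simp add: zariski_topology_def topology_inverse'[OF istopology_zariski])

lemma (in cring) topspace_zariski_topology: "topspace (zariski_topology R) = prime_spectrum R"
proof -
  have "\<not> carrier R \<subseteq> P" if "primeideal P R" for P
    using primeideal.I_notcarr[OF that]
      additive_subgroup.a_subset[OF ideal.axioms(1)[OF primeideal.axioms(1)[OF that]]]
    by blast
  then have "vanishing_locus R (carrier R) = {}"
    by (simp add: vanishing_locus_def prime_spectrum_def)
  then have "openin (zariski_topology R) (prime_spectrum R)"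
    unfolding openin_zariski_topology using oneideal by (intro exI[of _ "carrier R"]) simp
  moreover have "U \<subseteq> prime_spectrum R" if "openin (zariski_topology R) U" for U
    using that unfolding openin_zariski_topology by blast
  ultimately show ?thesis
    by (intro equalityI openin_subset) (auto simp: topspace_def)
qed

end

(* Connected components are cut out by the idempotents vanishing on them: a connected set of primes
   lies in V(e) or in V(1 - e) for every idempotent e. That V(M) is connected for max-regular M
   follows by lifting idempotents. If V(M) is the disjoint union of V(I) and V(J), then 1 = a + b
   with ab in every prime above M, so some power (ab)^n lies in M and is killed by 1 - e for an
   idempotent e of M. Writing 1 = a^n u + b^n v, the element (1 - e) a^n u is idempotent and
   separates V(I) from V(J); maximality of M puts it or its complement into M. *)
theory Submission
  imports Defs "HOL-Algebra.Ring_Divisibility" "HOL-Analysis.Abstract_Topological_Spaces"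
begin

section \<open>Existence of prime ideals\<close>

lemma (in ring) subset_add_ideals:
  assumes "ideal I R" "ideal J R"
  shows "I \<subseteq> I <+>\<^bsub>R\<^esub> J" "J \<subseteq> I <+>\<^bsub>R\<^esub> J"
proof -
  have "I \<union> J \<subseteq> carrier R"
    using assms by (meson Un_least additive_subgroup.a_subset ideal.axioms(1))
  from genideal_self[OF this] show "I \<subseteq> I <+>\<^bsub>R\<^esub> J" "J \<subseteq> I <+>\<^bsub>R\<^esub> J"
    unfolding union_genideal[OF assms] by auto
qed

text \<open>An ideal \<open>P\<close> that is maximal among the ideals above \<open>I\<close>
  missing the multiplicative set \<open>S\<close> is prime. If \<open>a\<close> and \<open>b\<close>
  lie outside \<open>P\<close>, then P + (a) and P + (b) are strictly larger, so both meet
  \<open>S\<close>; the product of the two meeting points lies in \<open>S\<close> and in P + (ab),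
  so \<open>ab\<close> cannot lie in \<open>P\<close>.\<close>

lemma (in cring) ex_primeideal_disjoint:
  assumes I: "ideal I R"
    and S: "S \<subseteq> carrier R" "\<one> \<in> S" "\<And>s t. s \<in> S \<Longrightarrow> t \<in> S \<Longrightarrow> s \<otimes> t \<in> S"
    and disj: "I \<inter> S = {}"
  shows "\<exists>P. primeideal P R \<and> I \<subseteq> P \<and> P \<inter> S = {}"
proof -
  let ?A = "{J. ideal J R \<and> I \<subseteq> J \<and> J \<inter> S = {}}"
  have "\<exists>P\<in>?A. \<forall>X\<in>?A. P \<subseteq> X \<longrightarrow> X = P"
  proof (rule subset_Zorn_nonempty)
    show "?A \<noteq> {}" using I disj by blast
    fix \<C> assume ne: "\<C> \<noteq> {}" and ch: "subset.chain ?A \<C>"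
    have sub: "\<C> \<subseteq> ?A" using ch by (simp add: pred_on.chain_def)
    have "subset.chain {J. ideal J R} \<C>" using ch by (auto simp: pred_on.chain_def)
    \<comment> \<open>The empty chain has to be excluded here: its union is the empty set, which is
      not an ideal. Hence the version of Zorn's lemma for nonempty chains.\<close>
    then have "ideal (\<Union>\<C>) R" using chain_Union_is_ideal[of \<C>] ne by simp
    then show "\<Union>\<C> \<in> ?A" using sub ne by blast
  qed
  then obtain P where P: "ideal P R" "I \<subseteq> P" "P \<inter> S = {}"
    and max: "\<And>X. ideal X R \<Longrightarrow> P \<subseteq> X \<Longrightarrow> X \<inter> S = {} \<Longrightarrow> X = P"
    by (smt (verit) mem_Collect_eq subset_trans)
  interpret P: ideal P R by fact
  have meet: "\<exists>p\<in>P. \<exists>r\<in>carrier R. p \<oplus> r \<otimes> a \<in> S" if a: "a \<in> carrier R" "a \<notin> P" for a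
  proof -
    note a_id = cgenideal_ideal[OF a(1)]
    have "a \<in> P <+>\<^bsub>R\<^esub> PIdl a"
      using subset_add_ideals(2)[OF P(1) a_id] cgenideal_self[OF a(1)] by blast
    then have "(P <+>\<^bsub>R\<^esub> PIdl a) \<inter> S \<noteq> {}"
      using max[OF add_ideals[OF P(1) a_id] subset_add_ideals(1)[OF P(1) a_id]] a(2) by blast
    then show ?thesis unfolding set_add_def' cgenideal_def by fastforce
  qed
  have "primeideal P R"
  proof (rule primeidealI[OF P(1) cring_axioms])
    show "carrier R \<noteq> P" using P(3) S(2) by auto
    fix a b assume ab: "a \<in> carrier R" "b \<in> carrier R" "a \<otimes> b \<in> P"
    show "a \<in> P \<or> b \<in> P"
    proof (rule ccontr)
      assume "\<not> (a \<in> P \<or> b \<in> P)"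
      then obtain p r q u where 1: "p \<in> P" "r \<in> carrier R" "p \<oplus> r \<otimes> a \<in> S"
        and 2: "q \<in> P" "u \<in> carrier R" "q \<oplus> u \<otimes> b \<in> S"
        using meet ab by metis
      note car = ab(1,2) 1(2) 2(2) P.Icarr[OF 1(1)] P.Icarr[OF 2(1)]
      \<comment> \<open>The product is sorted so that each summand has a factor known to be in
        \<open>P\<close>: \<open>p\<close>, \<open>q\<close> or the product of \<open>a\<close> and
        \<open>b\<close>.\<close>
      have "(p \<oplus> r \<otimes> a) \<otimes> (q \<oplus> u \<otimes> b)
          = (p \<otimes> (q \<oplus> u \<otimes> b) \<oplus> (r \<otimes> a) \<otimes> q) \<oplus> (r \<otimes> u) \<otimes> (a \<otimes> b)"
        using car by (simp add: l_distr r_distr m_ac a_ac)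
      also have "\<dots> \<in> P"
        by (intro P.a_closed P.I_r_closed[OF 1(1)] P.I_l_closed[OF 2(1)] P.I_l_closed[OF ab(3)])
          (use car in simp_all)
      finally show False using S(3)[OF 1(3) 2(3)] P(3) by blast
    qed
  qed
  with P show ?thesis by blast
qed

lemma (in cring) ex_primeideal_above:
  assumes I: "ideal I R" "I \<noteq> carrier R"
  shows "\<exists>P. primeideal P R \<and> I \<subseteq> P"
proof -
  have "\<one> \<notin> I" using ideal.one_imp_carrier[OF I(1)] I(2) by blast
  then show ?thesis using ex_primeideal_disjoint[OF I(1), of "{\<one>}"] by auto
qed

text \<open>The powers of \<open>x\<close> form a multiplicative set. If none of them were in
  \<open>I\<close>, some prime above \<open>I\<close> would avoid them all, \<open>x\<close>
  included. This is the nontrivial half of the description of the radical as an intersection of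
  primes.\<close>

lemma (in cring) nat_pow_in_ideal:
  assumes I: "ideal I R" and x: "x \<in> carrier R"
    and primes: "\<And>P. primeideal P R \<Longrightarrow> I \<subseteq> P \<Longrightarrow> x \<in> P"
  shows "\<exists>n::nat. x [^] n \<in> I"
proof (rule ccontr)
  let ?S = "range (\<lambda>n::nat. x [^] n)"
  assume "\<nexists>n::nat. x [^] n \<in> I"
  then have "\<exists>P. primeideal P R \<and> I \<subseteq> P \<and> P \<inter> ?S = {}"
  proof (intro ex_primeideal_disjoint[OF I])
    show "\<one> \<in> ?S" by (rule range_eqI[of _ _ 0]) simp
    show "s \<otimes> t \<in> ?S" if "s \<in> ?S" "t \<in> ?S" for s t
      using that x by (auto simp: nat_pow_mult)
  qed (use x in auto)
  moreover have "x \<in> ?S" by (rule range_eqI[of _ _ 1]) (use x in simp)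
  ultimately show False using primes by blast
qed

lemma (in primeideal) nat_pow_mem:
  assumes "x \<in> carrier R" "x [^] (n::nat) \<in> I"
  shows "x \<in> I"
  using assms(2)
proof (induction n)
  case 0
  then show ?case using one_imp_carrier I_notcarr by simp
next
  case (Suc n)
  then show ?case using I_prime[of "x [^] n" x] assms(1) by auto
qed

lemma (in primeideal) one_notin: "\<one> \<notin> I"
  using one_imp_carrier I_notcarr by blast

text \<open>A prime containing both n-th powers contains \<open>a\<close> and \<open>b\<close>,
  hence 1. So no prime lies above the ideal generated by the two powers, and no binomial expansion
  is required.\<close>

lemma (in cring) coprime_powers:
  assumes a: "a \<in> carrier R" and b: "b \<in> carrier R" and ab: "a \<oplus> b = \<one>"
  shows "\<exists>u\<in>carrier R. \<exists>v\<in>carrier R. u \<otimes> a [^] (n::nat) \<oplus> v \<otimes> b [^] n = \<one>"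
proof -
  note an = nat_pow_closed[OF a, of n] and bn = nat_pow_closed[OF b, of n]
  let ?K = "PIdl (a [^] n) <+>\<^bsub>R\<^esub> PIdl (b [^] n)"
  note ids = cgenideal_ideal[OF an] cgenideal_ideal[OF bn]
  have "?K = carrier R"
  proof (rule ccontr)
    assume "?K \<noteq> carrier R"
    then obtain P where "primeideal P R" "?K \<subseteq> P"
      using ex_primeideal_above[OF add_ideals[OF ids]] by blast
    interpret P: primeideal P R by fact
    have pow: "a [^] n \<in> P" "b [^] n \<in> P"
      using subset_add_ideals[OF ids] cgenideal_self[OF an] cgenideal_self[OF bn] \<open>?K \<subseteq> P\<close>
      by blast+
    have "a \<oplus> b \<in> P"
      using P.a_closed[OF P.nat_pow_mem[OF a pow(1)] P.nat_pow_mem[OF b pow(2)]] .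
    then show False using ab P.one_notin by simp
  qed
  then have "\<one> \<in> ?K" by simp
  then show ?thesis unfolding set_add_def' cgenideal_def by fastforce
qed

section \<open>Regular ideals and idempotents\<close>

lemma (in cring) idempotent_compl:
  assumes "idempotent_elem R e"
  shows "idempotent_elem R (\<one> \<ominus> e)" "e \<otimes> (\<one> \<ominus> e) = \<zero>" "e \<oplus> (\<one> \<ominus> e) = \<one>"
proof -
  have e: "e \<in> carrier R" "e \<otimes> e = e" using assms by (auto simp: idempotent_elem_def)
  show 2: "e \<otimes> (\<one> \<ominus> e) = \<zero>" using e by (simp add: a_minus_def r_distr r_minus r_neg)
  have "(\<one> \<ominus> e) \<otimes> (\<one> \<ominus> e) = (\<one> \<ominus> e) \<ominus> e \<otimes> (\<one> \<ominus> e)"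
    using e(1) by (simp add: a_minus_def l_distr l_minus)
  then show "idempotent_elem R (\<one> \<ominus> e)"
    unfolding idempotent_elem_def 2 using e by (simp add: a_minus_def)
  show "e \<oplus> (\<one> \<ominus> e) = \<one>" using e a_lcomm[of e \<one> "\<ominus> e"] by (simp add: a_minus_def r_neg)
qed

text \<open>The product of \<open>e\<close> and 1 - e is 0, so a prime contains one of them; their
  sum is 1, so it cannot contain both.\<close>

lemma (in primeideal) idempotent_mem_iff:
  assumes "idempotent_elem R e"
  shows "\<one> \<ominus> e \<in> I \<longleftrightarrow> e \<notin> I"
proof -
  note e = assms[unfolded idempotent_elem_def] and c = idempotent_compl[OF assms]
  have "e \<in> I \<or> \<one> \<ominus> e \<in> I" using I_prime[of e "\<one> \<ominus> e"] e c by simp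
  moreover have "\<not> (e \<in> I \<and> \<one> \<ominus> e \<in> I)" 
    using additive_subgroup.a_closed[OF additive_subgroup_axioms, of e "\<one> \<ominus> e"] c one_notin
    by auto
  ultimately show ?thesis by blast
qed

lemma (in ring) regular_ideal_ideal:
  assumes "regular_ideal R M" shows "ideal M R"
  using assms unfolding regular_ideal_def idempotent_elem_def by (metis genideal_ideal subsetI)

text \<open>The elements fixed by multiplication with some idempotent of \<open>M\<close> form an
  ideal that contains the generators of \<open>M\<close>. Only closure under sums takes work: two
  idempotents must be replaced by one that absorbs both.\<close>

lemma (in cring) regular_ideal_local_unit:
  assumes M: "regular_ideal R M" and x: "x \<in> M"
  shows "\<exists>e\<in>M. idempotent_elem R e \<and> x \<otimes> e = x"
proof -
  obtain E where E: "\<forall>e\<in>E. idempotent_elem R e" "M = Idl E"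
    using M by (auto simp: regular_ideal_def)
  have Ec: "E \<subseteq> carrier R" using E by (auto simp: idempotent_elem_def)
  interpret M: ideal M R using M by (rule regular_ideal_ideal)
  let ?J = "{x \<in> carrier R. \<exists>e\<in>M. idempotent_elem R e \<and> x \<otimes> e = x}"
  have "ideal ?J R"
  proof (rule idealI[OF ring_axioms])
    show "subgroup ?J (add_monoid R)"
    proof (rule subgroup.intro)
      show "?J \<subseteq> carrier (add_monoid R)" by auto
      show "\<one>\<^bsub>add_monoid R\<^esub> \<in> ?J"
        using M.zero_closed by (auto simp: idempotent_elem_def intro!: bexI[of _ \<zero>])
      fix x assume "x \<in> ?J"
      then show "inv\<^bsub>add_monoid R\<^esub> x \<in> ?J"
        by (auto simp: l_minus idempotent_elem_def simp flip: a_inv_def)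
    next
      fix x y assume "x \<in> ?J" "y \<in> ?J"
      then obtain e f where x: "x \<in> carrier R" and e: "e \<in> M" "e \<otimes> e = e" "x \<otimes> e = x"
        and y: "y \<in> carrier R" and f: "f \<in> M" "f \<otimes> f = f" "y \<otimes> f = y"
        by (auto simp: idempotent_elem_def)
      note car = M.Icarr[OF e(1)] M.Icarr[OF f(1)]
      \<comment> \<open>This is e + f - ef, the join of \<open>e\<close> and \<open>f\<close> in the
        Boolean algebra of idempotents. It satisfies eg = e and fg = f, so it fixes both
        \<open>x\<close> and \<open>y\<close>.\<close>
      define g where "g = e \<oplus> f \<otimes> (\<one> \<ominus> e)"
      have g: "g \<in> M" unfolding g_def using e f car by (intro M.a_closed M.I_r_closed) auto
      have e': "e \<otimes> (\<one> \<ominus> e) = \<zero>"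
        using car e by (simp add: a_minus_def r_distr r_minus r_neg)
      have eg: "e \<otimes> g = e"
      proof -
        have "e \<otimes> g = e \<otimes> e \<oplus> f \<otimes> (e \<otimes> (\<one> \<ominus> e))"
          unfolding g_def using car by (simp add: r_distr m_lcomm)
        then show ?thesis using e' e car by simp
      qed
      have fg: "f \<otimes> g = f"
      proof -
        have "f \<otimes> g = f \<otimes> e \<oplus> (f \<otimes> f) \<otimes> (\<one> \<ominus> e)"
          unfolding g_def using car by (simp add: r_distr m_assoc)
        also have "\<dots> = f \<otimes> (e \<oplus> (\<one> \<ominus> e))" using f car by (simp add: r_distr)
        also have "e \<oplus> (\<one> \<ominus> e) = \<one>" using car a_lcomm[of e \<one> "\<ominus> e"] by (simp add: a_minus_def r_neg)
        finally show ?thesis using car by simp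
      qed
      have gc: "g \<in> carrier R" using g by (rule M.Icarr)
      have xg: "x \<otimes> g = x" using e(3) eg m_assoc[OF x car(1) gc] by simp
      have yg: "y \<otimes> g = y" using f(3) fg m_assoc[OF y car(2) gc] by simp
      \<comment> \<open>Stated for an arbitrary \<open>c\<close> so that 1 - e stays unexpanded when
        it is substituted. The absorption laws then turn the right-hand side back into
        \<open>g\<close>.\<close>
      have "(e \<oplus> f \<otimes> c) \<otimes> g = e \<otimes> g \<oplus> (f \<otimes> g) \<otimes> c" if "c \<in> carrier R" for c
        using that car gc by (simp add: l_distr m_assoc m_comm[OF gc, of c])
      from this[of "\<one> \<ominus> e"]
      have "g \<otimes> g = e \<otimes> g \<oplus> (f \<otimes> g) \<otimes> (\<one> \<ominus> e)" using car by (simp flip: g_def)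
      then have "g \<otimes> g = g" unfolding eg fg by (simp add: g_def)
      moreover have "(x \<oplus> y) \<otimes> g = x \<oplus> y" using x y gc xg yg by (simp add: l_distr)
      ultimately show "x \<otimes>\<^bsub>add_monoid R\<^esub> y \<in> ?J"
        using x y g gc by (auto simp: idempotent_elem_def)
    qed
  next
    fix a x assume a: "a \<in> ?J" and x: "x \<in> carrier R"
    then obtain e where e: "e \<in> M" "idempotent_elem R e" "a \<otimes> e = a" by blast
    have "(x \<otimes> a) \<otimes> e = x \<otimes> a" using a x e M.Icarr by (simp add: m_assoc)
    then show "x \<otimes> a \<in> ?J" using a x e by blast
    then show "a \<otimes> x \<in> ?J" using a x m_comm[of a x] by simp
  qed
  moreover have "E \<subseteq> ?J"
    using E genideal_self[OF Ec] by (auto simp: idempotent_elem_def)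
  ultimately have "M \<subseteq> ?J" using genideal_minimal E(2) by blast
  then show ?thesis using x by blast
qed

text \<open>Modulo the radical of \<open>M\<close> the element \<open>a\<close> is idempotent, since
  a(1 - a) = ab. The lift \<open>g\<close> is an idempotent of the ring itself and not only of the
  quotient by \<open>M\<close>: a power of ab lies in \<open>M\<close>, so it is fixed by an
  idempotent \<open>e\<close> of \<open>M\<close> and annihilated by f = 1 - e.\<close>

lemma (in cring) lift_idempotent:
  assumes M: "regular_ideal R M"
    and a: "a \<in> carrier R" and b: "b \<in> carrier R" and ab: "a \<oplus> b = \<one>"
    and nil: "\<And>P. primeideal P R \<Longrightarrow> M \<subseteq> P \<Longrightarrow> a \<otimes> b \<in> P"
  shows "\<exists>g. idempotent_elem R g \<and> (\<forall>P. primeideal P R \<longrightarrow> M \<subseteq> P \<longrightarrow> (g \<in> P \<longleftrightarrow> a \<in> P))"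
proof -
  interpret M: ideal M R using M by (rule regular_ideal_ideal)
  obtain k :: nat where k: "(a \<otimes> b) [^] k \<in> M"
    using nat_pow_in_ideal[OF M.ideal_axioms] nil a b by blast
  \<comment> \<open>A positive exponent makes the n-th powers multiples of \<open>a\<close> and
    \<open>b\<close>; with exponent 0 membership of \<open>a\<close> in a prime would say nothing
    about \<open>A\<close>.\<close>
  define n where "n = Suc k"
  have "(a \<otimes> b) [^] n \<in> M"
    unfolding n_def nat_pow_Suc using M.I_r_closed[OF k] a b by simp
  then obtain e where e: "e \<in> M" "idempotent_elem R e" "(a \<otimes> b) [^] n \<otimes> e = (a \<otimes> b) [^] n"
    using regular_ideal_local_unit[OF M] by blast
  define f where "f = \<one> \<ominus> e"
  have f: "f \<in> carrier R" "f \<otimes> f = f"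
    using idempotent_compl[OF e(2)] by (auto simp: f_def idempotent_elem_def)
  have ec: "e \<in> carrier R" using e(2) by (simp add: idempotent_elem_def)
  \<comment> \<open>The local unit \<open>e\<close> may be inserted before multiplying by
    \<open>f\<close>, and ef = 0.\<close>
  have "((a \<otimes> b) [^] n \<otimes> e) \<otimes> f = \<zero>"
    using idempotent_compl(2)[OF e(2)] a b ec f by (simp add: m_assoc flip: f_def)
  then have kill: "a [^] n \<otimes> b [^] n \<otimes> f = \<zero>" using e(3) a b by (simp add: nat_pow_distrib)
  obtain u v where u: "u \<in> carrier R" and v: "v \<in> carrier R"
    and uv: "u \<otimes> a [^] n \<oplus> v \<otimes> b [^] n = \<one>"
    using coprime_powers[OF a b ab] by blast
  define A where "A = u \<otimes> a [^] n"
  define B where "B = v \<otimes> b [^] n"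
  have A: "A \<in> carrier R" and B: "B \<in> carrier R" using a b u v by (auto simp: A_def B_def)
  have "A \<otimes> B \<otimes> f = (u \<otimes> v) \<otimes> (a [^] n \<otimes> b [^] n \<otimes> f)"
    unfolding A_def B_def using a b u v f by (simp add: m_ac)
  then have ABf: "A \<otimes> B \<otimes> f = \<zero>" using kill u v by simp
  have AB: "A \<oplus> B = \<one>" using uv by (simp add: A_def B_def)
  \<comment> \<open>From A + B = 1 and ABf = 0 follows fA = fA(A + B) = fAA, which equals the square
    of fA because \<open>f\<close> is idempotent.\<close>
  have "f \<otimes> A = f \<otimes> (A \<otimes> (A \<oplus> B))" using AB A by simp
  also have "\<dots> = f \<otimes> (A \<otimes> A) \<oplus> A \<otimes> B \<otimes> f"
    using A B f by (simp only: r_distr m_closed a_closed m_ac)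
  also have "\<dots> = (f \<otimes> f) \<otimes> (A \<otimes> A)" using ABf A f by simp
  also have "\<dots> = (f \<otimes> A) \<otimes> (f \<otimes> A)" using A f(1) by (simp only: m_closed m_ac)
  finally have idem: "idempotent_elem R (f \<otimes> A)" using A f by (simp add: idempotent_elem_def)
  have "f \<otimes> A \<in> P \<longleftrightarrow> a \<in> P" if "primeideal P R" and MP: "M \<subseteq> P" for P
  proof
    interpret P: primeideal P R by fact
    {
      assume "a \<in> P"
      then have "(f \<otimes> u \<otimes> a [^] k) \<otimes> a \<in> P" using f u a by (intro P.I_l_closed) auto
      then show "f \<otimes> A \<in> P" using f u a by (simp add: A_def n_def m_assoc)
    }
    assume "f \<otimes> A \<in> P"
    moreover have "f \<notin> P" using P.idempotent_mem_iff[OF e(2)] e(1) MP by (auto simp: f_def)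
    ultimately have AP: "A \<in> P" using P.I_prime f A by blast
    \<comment> \<open>If \<open>b\<close> were in \<open>P\<close>, so would be its multiple
      \<open>B\<close>, and then A + B = 1. As \<open>P\<close> contains ab, only \<open>a\<close>
      is left.\<close>
    have "b \<notin> P"
    proof
      assume "b \<in> P"
      then have "(v \<otimes> b [^] k) \<otimes> b \<in> P" using v b by (intro P.I_l_closed) auto
      then have "B \<in> P" using v b by (simp add: B_def n_def m_assoc)
      from P.a_closed[OF AP this] show False using AB P.one_notin by simp
    qed
    then show "a \<in> P" using P.I_prime[OF a b] nil[OF that] by blast
  qed
  with idem show ?thesis by blast
qed

text \<open>Adjoining \<open>e\<close> to the generators of \<open>M\<close> gives a regular ideal.
  If it is proper, maximality makes it \<open>M\<close>. Otherwise 1 = m + re with \<open>m\<close>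
  in \<open>M\<close>, and multiplying by 1 - e kills the term re, leaving 1 - e = m(1 - e) in
  \<open>M\<close>.\<close>

lemma (in cring) max_regular_ideal_idempotent_cases:
  assumes M: "max_regular_ideal R M" and e: "idempotent_elem R e"
  shows "e \<in> M \<or> \<one> \<ominus> e \<in> M"
proof -
  have reg: "regular_ideal R M"
    using M by (auto simp: max_regular_ideal_def proper_regular_ideal_def)
  interpret M: ideal M R using reg by (rule regular_ideal_ideal)
  obtain E where E: "\<forall>e\<in>E. idempotent_elem R e" "M = Idl E"
    using reg by (auto simp: regular_ideal_def)
  have Ec: "insert e E \<subseteq> carrier R" using E e by (auto simp: idempotent_elem_def)
  have ec: "e \<in> carrier R" using Ec by simp
  let ?J = "Idl (insert e E)"
  have sup: "insert e E \<subseteq> ?J" using genideal_self[OF Ec] .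
  then have MJ: "M \<subseteq> ?J" using genideal_minimal[OF genideal_ideal[OF Ec]] E(2) by blast
  have regJ: "regular_ideal R ?J" using E(1) e unfolding regular_ideal_def by blast
  show ?thesis
  proof (cases "?J = carrier R")
    case False
    then have "?J = M" using M MJ regJ by (auto simp: max_regular_ideal_def proper_regular_ideal_def)
    then show ?thesis using sup by blast
  next
    case True
    note ids = M.ideal_axioms cgenideal_ideal[OF ec]
    have "insert e E \<subseteq> M <+>\<^bsub>R\<^esub> PIdl e"
      using subset_add_ideals[OF ids] cgenideal_self[OF ec] genideal_self[of E] Ec E(2) by blast
    then have "?J \<subseteq> M <+>\<^bsub>R\<^esub> PIdl e" by (rule genideal_minimal[OF add_ideals[OF ids]])
    then have "\<one> \<in> M <+>\<^bsub>R\<^esub> PIdl e" using True by auto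
    then obtain m r where m: "m \<in> M" and r: "r \<in> carrier R" and 1: "\<one> = m \<oplus> r \<otimes> e"
      unfolding set_add_def' cgenideal_def by fastforce
    note c = idempotent_compl[OF e]
    have cc: "\<one> \<ominus> e \<in> carrier R" using ec by simp
    have "\<one> \<ominus> e = (m \<oplus> r \<otimes> e) \<otimes> (\<one> \<ominus> e)" using cc by (simp flip: 1)
    also have "\<dots> = m \<otimes> (\<one> \<ominus> e) \<oplus> r \<otimes> (e \<otimes> (\<one> \<ominus> e))"
      using M.Icarr[OF m] r ec cc by (simp add: l_distr m_assoc)
    also have "\<dots> = m \<otimes> (\<one> \<ominus> e)" using c(2) r M.Icarr[OF m] cc by simp
    finally have "\<one> \<ominus> e \<in> M" using M.I_r_closed[OF m cc] by simp
    then show ?thesis ..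
  qed
qed

section \<open>Connected subsets of the spectrum\<close>

lemma (in cring) closedin_zariski_topology:
  "closedin (zariski_topology R) U \<longleftrightarrow> (\<exists>I. ideal I R \<and> U = vanishing_locus R I)"
  unfolding closedin_def openin_zariski_topology topspace_zariski_topology
  by (auto simp: vanishing_locus_def)

lemma (in cring) vanishing_locus_genideal:
  assumes "S \<subseteq> carrier R"
  shows "vanishing_locus R (Idl S) = vanishing_locus R S"
  using genideal_self[OF assms] genideal_minimal[OF primeideal.axioms(1)]
  unfolding vanishing_locus_def prime_spectrum_def by blast

lemma (in cring) vanishing_locus_idempotent_compl:
  assumes "idempotent_elem R e"
  shows "vanishing_locus R {\<one> \<ominus> e} = prime_spectrum R - vanishing_locus R {e}"
  using primeideal.idempotent_mem_iff[OF _ assms]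
  by (auto simp: vanishing_locus_def prime_spectrum_def)

lemma (in cring) closedin_vanishing_locus_idempotent:
  assumes "idempotent_elem R e"
  shows "closedin (zariski_topology R) (vanishing_locus R {e})"
  using assms genideal_ideal[of "{e}"] vanishing_locus_genideal[of "{e}"]
  unfolding closedin_zariski_topology idempotent_elem_def by force

text \<open>V(e) and V(1 - e) are closed and complementary, so V(e) is clopen and a connected set
  lies on one side of it.\<close>

lemma (in cring) connectedin_idempotent_cases:
  assumes C: "connectedin (zariski_topology R) C" and e: "idempotent_elem R e"
  shows "C \<subseteq> vanishing_locus R {e} \<or> C \<subseteq> vanishing_locus R {\<one> \<ominus> e}"
proof -
  note compl = idempotent_compl(1)[OF e]
  have "openin (zariski_topology R) (vanishing_locus R {e})"
    using closedin_vanishing_locus_idempotent[OF compl]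
    unfolding openin_closedin_eq vanishing_locus_idempotent_compl[OF e] topspace_zariski_topology
    by (auto simp: vanishing_locus_def)
  from connectedin_clopen_cases[OF C closedin_vanishing_locus_idempotent[OF e] this]
  show ?thesis
    using connectedin_subset_topspace[OF C]
    unfolding vanishing_locus_idempotent_compl[OF e] topspace_zariski_topology disjnt_def by blast
qed

lemma (in cring) vanishing_locus_nonempty:
  assumes "proper_regular_ideal R M" shows "vanishing_locus R M \<noteq> {}"
  using assms ex_primeideal_above[of M] regular_ideal_ideal
  by (auto simp: proper_regular_ideal_def vanishing_locus_def prime_spectrum_def)

text \<open>A separation of V(M) yields an idempotent lying in a prime \<open>P\<close> on one side
  and outside a prime \<open>Q\<close> on the other. Then neither it nor its complement can be in
  \<open>M\<close>, against the dichotomy for max-regular ideals.\<close>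

lemma (in cring) connectedin_max_regular_ideal:
  assumes M: "max_regular_ideal R M"
  shows "connectedin (zariski_topology R) (vanishing_locus R M)"
  unfolding connectedin_closedin
proof (intro conjI notI)
  show "vanishing_locus R M \<subseteq> topspace (zariski_topology R)"
    by (auto simp: vanishing_locus_def topspace_zariski_topology)
  have reg: "regular_ideal R M"
    using M by (auto simp: max_regular_ideal_def proper_regular_ideal_def)
  note Mid = regular_ideal_ideal[OF reg]
  assume "\<exists>E1 E2. closedin (zariski_topology R) E1 \<and> closedin (zariski_topology R) E2 \<and>
    vanishing_locus R M \<subseteq> E1 \<union> E2 \<and> E1 \<inter> E2 \<inter> vanishing_locus R M = {} \<and>
    E1 \<inter> vanishing_locus R M \<noteq> {} \<and> E2 \<inter> vanishing_locus R M \<noteq> {}"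
  then obtain I J where I: "ideal I R" and J: "ideal J R"
    and cover: "vanishing_locus R M \<subseteq> vanishing_locus R I \<union> vanishing_locus R J"
    and disj: "vanishing_locus R I \<inter> vanishing_locus R J \<inter> vanishing_locus R M = {}"
    and ne: "vanishing_locus R I \<inter> vanishing_locus R M \<noteq> {}"
      "vanishing_locus R J \<inter> vanishing_locus R M \<noteq> {}"
    unfolding closedin_zariski_topology by blast
  note JM = add_ideals[OF J Mid]
  \<comment> \<open>A prime above I + J + M would be a common point of the two disjoint pieces of
    V(M), so this sum is the whole ring.\<close>
  let ?K = "I <+>\<^bsub>R\<^esub> (J <+>\<^bsub>R\<^esub> M)"
  have "?K = carrier R"
  proof (rule ccontr)
    assume "?K \<noteq> carrier R"
    then obtain P where "primeideal P R" "?K \<subseteq> P"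
      using ex_primeideal_above[OF add_ideals[OF I JM]] by blast
    then have "I \<subseteq> P" "J \<subseteq> P" "M \<subseteq> P"
      using subset_add_ideals[OF I JM] subset_add_ideals[OF J Mid] by blast+
    then have "P \<in> vanishing_locus R I \<inter> vanishing_locus R J \<inter> vanishing_locus R M"
      using \<open>primeideal P R\<close> by (simp add: vanishing_locus_def prime_spectrum_def)
    then show False using disj by blast
  qed
  then have "\<one> \<in> ?K" by simp
  then obtain a j m where a: "a \<in> I" and j: "j \<in> J" and m: "m \<in> M" and ab: "a \<oplus> (j \<oplus> m) = \<one>"
    unfolding set_add_def' by force
  \<comment> \<open>The summand from \<open>M\<close> is absorbed into \<open>b\<close>, which costs
    nothing: only primes above \<open>M\<close> matter, and those above \<open>J\<close> as well
    still contain \<open>b\<close>.\<close>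
  define b where "b = j \<oplus> m"
  have car: "a \<in> carrier R" "b \<in> carrier R"
    using a j m I J Mid by (auto simp: b_def ideal.Icarr)
  have b_mem: "b \<in> P" if "primeideal P R" "J \<subseteq> P" "M \<subseteq> P" for P
    unfolding b_def using that j m
    by (intro additive_subgroup.a_closed[OF ideal.axioms(1)[OF primeideal.axioms(1)]]) auto
  have "a \<otimes> b \<in> P" if "primeideal P R" "M \<subseteq> P" for P
  proof -
    have "I \<subseteq> P \<or> J \<subseteq> P" using that cover by (auto simp: vanishing_locus_def prime_spectrum_def)
    then have "a \<in> P \<or> b \<in> P" using a b_mem that by blast
    then show ?thesis
      using ideal.I_l_closed ideal.I_r_closed primeideal.axioms(1)[OF that(1)] car by metis
  qed
  then obtain g where g: "idempotent_elem R g"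
    and g_iff: "\<And>P. primeideal P R \<Longrightarrow> M \<subseteq> P \<Longrightarrow> g \<in> P \<longleftrightarrow> a \<in> P"
    using lift_idempotent[OF reg car] ab unfolding b_def by blast
  obtain P where P: "primeideal P R" "M \<subseteq> P" "I \<subseteq> P"
    using ne(1) by (auto simp: vanishing_locus_def prime_spectrum_def)
  obtain Q where Q: "primeideal Q R" "M \<subseteq> Q" "J \<subseteq> Q"
    using ne(2) by (auto simp: vanishing_locus_def prime_spectrum_def)
  interpret Q: primeideal Q R by fact
  have "g \<in> P" using g_iff[OF P(1,2)] a P(3) by blast
  then have "\<one> \<ominus> g \<notin> M" using primeideal.idempotent_mem_iff[OF P(1) g] P(2) by blast
  \<comment> \<open>\<open>Q\<close> contains \<open>b\<close>, and a + b = 1.\<close>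
  moreover have "a \<notin> Q"
    using Q.a_closed[of a b] b_mem[OF Q(1,3,2)] ab Q.one_notin by (auto simp: b_def)
  then have "g \<notin> M" using g_iff[OF Q(1,2)] Q(2) by blast
  ultimately show False using max_regular_ideal_idempotent_cases[OF M g] by blast
qed

text \<open>V(M) is the intersection of the clopen sets V(e) over idempotent generators
  \<open>e\<close>. A connected set meeting V(M) meets each of them, so it lies in each.\<close>

lemma (in cring) connectedin_subset_vanishing_locus:
  assumes C: "connectedin (zariski_topology R) C" and M: "regular_ideal R M"
    and meet: "C \<inter> vanishing_locus R M \<noteq> {}"
  shows "C \<subseteq> vanishing_locus R M"
proof -
  obtain E where E: "\<forall>e\<in>E. idempotent_elem R e" "M = Idl E"
    using M by (auto simp: regular_ideal_def)
  have Ec: "E \<subseteq> carrier R" using E by (auto simp: idempotent_elem_def)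
  have VM: "vanishing_locus R M = vanishing_locus R E"
    unfolding E(2) by (rule vanishing_locus_genideal[OF Ec])
  have "C \<subseteq> vanishing_locus R {e}" if "e \<in> E" for e
  proof -
    have e: "idempotent_elem R e" using E that by blast
    have "\<not> C \<subseteq> vanishing_locus R {\<one> \<ominus> e}"
      using meet that unfolding VM vanishing_locus_idempotent_compl[OF e]
      by (auto simp: vanishing_locus_def)
    then show ?thesis using connectedin_idempotent_cases[OF C e] by blast
  qed
  moreover have "C \<subseteq> prime_spectrum R"
    using connectedin_subset_topspace[OF C] by (simp add: topspace_zariski_topology)
  ultimately show ?thesis unfolding VM by (auto simp: vanishing_locus_def)
qed

text \<open>The ideal is contained in every prime of the nonempty set \<open>C\<close>, hence
  proper. For maximality, every idempotent generator \<open>f\<close> of a larger proper regular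
  ideal must already vanish on \<open>C\<close>: by connectedness the alternative is that 1 - f
  does.\<close>

lemma (in cring) max_regular_ideal_of_connectedin:
  assumes C: "connectedin (zariski_topology R) C" and ne: "C \<noteq> {}"
  shows "max_regular_ideal R (Idl {e. idempotent_elem R e \<and> C \<subseteq> vanishing_locus R {e}})"
    (is "max_regular_ideal R (Idl ?E)")
    and "C \<subseteq> vanishing_locus R (Idl {e. idempotent_elem R e \<and> C \<subseteq> vanishing_locus R {e}})"
proof -
  have Ec: "?E \<subseteq> carrier R" by (auto simp: idempotent_elem_def)
  have Cs: "C \<subseteq> prime_spectrum R"
    using connectedin_subset_topspace[OF C] by (simp add: topspace_zariski_topology)
  then show sub: "C \<subseteq> vanishing_locus R (Idl ?E)"
    unfolding vanishing_locus_genideal[OF Ec] by (auto simp: vanishing_locus_def)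
  obtain P where P: "primeideal P R" "Idl ?E \<subseteq> P"
    using ne sub by (auto simp: vanishing_locus_def prime_spectrum_def)
  interpret P: primeideal P R by fact
  show "max_regular_ideal R (Idl ?E)"
    unfolding max_regular_ideal_def
  proof (intro conjI allI impI)
    have "Idl ?E \<noteq> carrier R" using P(2) P.one_notin by auto
    then show "proper_regular_ideal R (Idl ?E)"
      unfolding proper_regular_ideal_def regular_ideal_def by (intro conjI exI[of _ ?E]) auto
    fix J assume J: "proper_regular_ideal R J" and EJ: "Idl ?E \<subseteq> J"
    obtain F where F: "\<forall>f\<in>F. idempotent_elem R f" "J = Idl F"
      using J by (auto simp: proper_regular_ideal_def regular_ideal_def)
    have Fc: "F \<subseteq> carrier R" using F by (auto simp: idempotent_elem_def)
    interpret J: ideal J R using genideal_ideal[OF Fc] F(2) by simp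
    have "F \<subseteq> ?E"
    proof
      fix f assume f: "f \<in> F"
      then have idem: "idempotent_elem R f" using F by blast
      have fJ: "f \<in> J" using f genideal_self[OF Fc] F(2) by blast
      \<comment> \<open>Otherwise \<open>J\<close> would contain both \<open>f\<close> and 1 - f,
        whose sum is 1.\<close>
      have "\<one> \<ominus> f \<notin> ?E"
      proof
        assume "\<one> \<ominus> f \<in> ?E"
        then have "\<one> \<ominus> f \<in> J" using genideal_self[OF Ec] EJ by blast
        from J.a_closed[OF fJ this] have "\<one> \<in> J" by (simp only: idempotent_compl(3)[OF idem])
        then show False using J.one_imp_carrier J by (auto simp: proper_regular_ideal_def)
      qed
      then show "f \<in> ?E"
        using connectedin_idempotent_cases[OF C idem] idem idempotent_compl(1)[OF idem] by blast
    qed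
    then have "J \<subseteq> Idl ?E"
      using genideal_minimal[OF genideal_ideal[OF Ec]] genideal_self[OF Ec] F(2) by blast
    then show "J = Idl ?E" using EJ by blast
  qed
qed

theorem theorem3p5:
  fixes R :: "('a, 'b) ring_scheme" and C :: "'a set set"
  assumes "cring R"
    and "C \<subseteq> prime_spectrum R"
  shows "C \<in> connected_components_of (zariski_topology R) \<longleftrightarrow>
    (\<exists>M. max_regular_ideal R M \<and> C = vanishing_locus R M)"
proof
  interpret cring R by fact
  {
    assume C: "C \<in> connected_components_of (zariski_topology R)"
    have conn: "connectedin (zariski_topology R) C"
      using C connectedin_connected_component_of by (auto simp: connected_components_of_def)
    note ne = nonempty_connected_components_of[OF C]
    define M where "M = Idl\<^bsub>R\<^esub> {e. idempotent_elem R e \<and> C \<subseteq> vanishing_locus R {e}}"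
    note M = max_regular_ideal_of_connectedin[OF conn ne, folded M_def]
    \<comment> \<open>V(M) is connected and contains the nonempty component \<open>C\<close>, so
      maximality of the component forces equality.\<close>
    have "vanishing_locus R M \<subseteq> C"
      using connected_components_of_maximal[OF C connectedin_max_regular_ideal[OF M(1)]] M(2) ne
      by (auto simp: disjnt_def)
    with M show "\<exists>M. max_regular_ideal R M \<and> C = vanishing_locus R M" by blast
  next
    assume "\<exists>M. max_regular_ideal R M \<and> C = vanishing_locus R M"
    then obtain M where M: "max_regular_ideal R M" and C: "C = vanishing_locus R M" by blast
    have proper: "proper_regular_ideal R M" using M by (simp add: max_regular_ideal_def)
    obtain P where P: "P \<in> C" using vanishing_locus_nonempty[OF proper] C by blast
    let ?D = "connected_component_of_set (zariski_topology R) P"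
    have PX: "P \<in> topspace (zariski_topology R)"
      using P assms(2) by (auto simp: topspace_zariski_topology)
    have "C \<subseteq> ?D"
      using connected_component_of_maximal[OF connectedin_max_regular_ideal[OF M]] P C by blast
    \<comment> \<open>The component of \<open>P\<close> is connected and meets V(M) in
      \<open>P\<close>; as \<open>M\<close> is regular, it cannot leave V(M).\<close>
    moreover have "?D \<subseteq> C"
      unfolding C
      by (rule connectedin_subset_vanishing_locus[OF connectedin_connected_component_of])
        (use proper P C \<open>C \<subseteq> ?D\<close> in \<open>auto simp: proper_regular_ideal_def\<close>)
    ultimately have "C = ?D" by blast
    then show "C \<in> connected_components_of (zariski_topology R)"
      using PX by (auto simp: connected_components_of_def)
  }
qed

end
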